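(* The algorithm PA-I is convergent: for the error $E_n^k=U(T_n)-U_n^k$ and every $k\ge0$, $$\max_{1\le j\le N}\|E_j^{k+1}\|\le \alpha^{k+1}\min\left\{\left(\frac{1-\beta^{N-1}}{1-\beta}\right)^{k+1},\binom{N-1}{k+1}\right\}\max_{1\le j\le N}\|E_j^0\|,$$ where $\alpha=\|P_{J_1}-P_1\|$ and $\beta=\|P_1\|$.
   Context: Let $h>0$, let $N_x\ge 3$ be an integer, and let $D_h=\frac1{h^2}\,\mathrm{tridiag}(1,-2,1)\in\mathbb{R}^{(N_x-2)\times(N_x-2)}$ be the discrete Dirichlet Laplacian (diagonal entries $-2/h^2$, sub- and superdiagonal entries $1/h^2$, all others $0$). Let $\epsilon>0$, $T>0$, integers $N\ge1$ and $J\ge2$, $\Delta T=T/N$, $\Delta t=\Delta T/J$, $T_n=n\Delta T$. $\|\cdot\|$ is the Euclidean norm on $\mathbb{R}^{N_x-2}$ and the induced matrix norm. For $i\in\{1,2\}$ set $$P_i=(I-i\Delta T D_h+\epsilon^2\Delta T D_h^2)^{-1}(I-i\Delta T D_h),\qquad P_{J_i}=\Big[\big(I-\tfrac{i\Delta T}{J}D_h+\epsilon^2\tfrac{\Delta T}{J}D_h^2\big)^{-1}\big(I-\tfrac{i\Delta T}{J}D_h\big)\Big]^J .$$ Parareal iteration: given a fine propagator $\mathcal F$ and a coarse propagator $\mathcal G$ (maps $\mathbb{R}^{N_x-2}\to\mathbb{R}^{N_x-2}$ advancing the solution from $T_n$ to $T_{n+1}$) and $u^0\in\mathbb{R}^{N_x-2}$,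 the initial guess is $U_0^0=u^0$, $U_{n+1}^0=\mathcal G(U_n^0)$, and for $k=0,1,2,\dots$ $$U_0^{k+1}=u^0,\qquad U_{n+1}^{k+1}=\mathcal G(U_n^{k+1})+\mathcal F(U_n^k)-\mathcal G(U_n^k),\quad 0\le n\le N-1.$$ The discrete fine solution is $U(T_0)=u^0$, $U(T_{n+1})=\mathcal F(U(T_n))$. PA-I (in the form analyzed): the Parareal iteration with $\mathcal F(U)=P_{J_1}U$ and $\mathcal G(U)=P_1U$. These are the propagators of the linearized convex-splitting scheme $\frac{W^{n+1}-W^n}{\Delta t}=D_h\,\mathrm{diag}(W^n)^2W^{n+1}-\epsilon^2D_h^2W^{n+1}-D_hW^n$ for the Cahn-Hilliard equation, with the term $\mathrm{diag}(W^n)^2$ replaced by $I$; $\mathcal F$ takes $J$ steps of size $\Delta t$ and $\mathcal G$ one step of size $\Delta T$. Convention: $\binom{a}{b}=0$ if $b>a\ge 0$. *)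

theory Defs
  imports "HOL-Analysis.Analysis"
begin

text \<open>
  Vectors with \<open>m\<close> entries live in \<open>real ^ 'n\<close> with \<open>CARD('n) = m\<close>.  A linear order on \<open>'n\<close> says
  which rows and columns are adjacent: \<open>pos i\<close> is the zero-based position of \<open>i\<close> in that order.
  Every finite size occurs, e.g. with the numeral types.
\<close>

definition pos :: "'n::{finite,linorder} \<Rightarrow> nat" where
  "pos i = card {..<i}"

text \<open>Argument order: subdiagonal, diagonal, superdiagonal.\<close>

definition tridiag :: "real \<Rightarrow> real \<Rightarrow> real \<Rightarrow> real ^ ('n::{finite,linorder}) ^ ('n::{finite,linorder})" where
  "tridiag a d c = (\<chi> i j.
     if i = j then d
     else if pos i = Suc (pos j) then a
     else if pos j = Suc (pos i) then c
     else 0)"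

definition D_mat :: "real \<Rightarrow> real ^ ('n::{finite,linorder}) ^ ('n::{finite,linorder})" where
  "D_mat h = (1 / h\<^sup>2) *\<^sub>R tridiag 1 (-2) 1"

text \<open>The operation \<open>^\<close> on \<open>real ^ 'n ^ 'n\<close> would be taken entrywise, hence the iteration of \<open>(**)\<close>.\<close>

definition mat_pow :: "real ^ 'n ^ 'n \<Rightarrow> nat \<Rightarrow> real ^ 'n ^ 'n" where
  "mat_pow A k = (((**) A) ^^ k) (mat 1)"

definition mat_norm :: "real ^ 'n ^ 'm \<Rightarrow> real" where
  "mat_norm A = onorm ((*v) A)"

text \<open>
  One step of size \<open>\<tau>\<close> of the linearized scheme.  For \<open>i = 1\<close> it solves
  \<open>(W' - W) / \<tau> = D W' - \<epsilon>\<^sup>2 D\<^sup>2 W' - D W\<close>, where \<open>diag(W)\<^sup>2\<close> has been replaced by the identity.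
\<close>

definition step_mat :: "nat \<Rightarrow> real \<Rightarrow> real \<Rightarrow> real \<Rightarrow> real ^ ('n::{finite,linorder}) ^ ('n::{finite,linorder})" where
  "step_mat i h \<epsilon> \<tau> =
     matrix_inv (mat 1 - (real i * \<tau>) *\<^sub>R D_mat h + (\<epsilon>\<^sup>2 * \<tau>) *\<^sub>R mat_pow (D_mat h) 2)
     ** (mat 1 - (real i * \<tau>) *\<^sub>R D_mat h)"

definition P_mat :: "nat \<Rightarrow> real \<Rightarrow> real \<Rightarrow> real \<Rightarrow> real ^ ('n::{finite,linorder}) ^ ('n::{finite,linorder})" where
  "P_mat i h \<epsilon> \<Delta>T = step_mat i h \<epsilon> \<Delta>T"

definition PJ_mat :: "nat \<Rightarrow> nat \<Rightarrow> real \<Rightarrow> real \<Rightarrow> real \<Rightarrow> real ^ ('n::{finite,linorder}) ^ ('n::{finite,linorder})" where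
  "PJ_mat J i h \<epsilon> \<Delta>T = mat_pow (step_mat i h \<epsilon> (\<Delta>T / real J)) J"

text \<open>
  \<open>parareal F G u0 k n\<close> is \<open>U\<^sub>n\<^sup>k\<close>.  The recursion runs over all \<open>n\<close>; the value at \<open>n\<close> only uses
  values at positions up to \<open>n\<close>, so cutting off at \<open>n \<le> N\<close> changes nothing.
\<close>

fun parareal :: "('v::ab_group_add \<Rightarrow> 'v) \<Rightarrow> ('v \<Rightarrow> 'v) \<Rightarrow> 'v \<Rightarrow> nat \<Rightarrow> nat \<Rightarrow> 'v" where
  "parareal F G u0 k 0 = u0"
| "parareal F G u0 0 (Suc n) = G (parareal F G u0 0 n)"
| "parareal F G u0 (Suc k) (Suc n) =
     G (parareal F G u0 (Suc k) n) + F (parareal F G u0 k n) - G (parareal F G u0 k n)"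

definition fine_solution :: "('v \<Rightarrow> 'v) \<Rightarrow> 'v \<Rightarrow> nat \<Rightarrow> 'v" where
  "fine_solution F u0 n = (F ^^ n) u0"

definition PA_I_fine ::
  "nat \<Rightarrow> real \<Rightarrow> real \<Rightarrow> real \<Rightarrow> real ^ ('n::{finite,linorder}) \<Rightarrow> real ^ ('n::{finite,linorder})" where
  "PA_I_fine J h \<epsilon> \<Delta>T U = PJ_mat J 1 h \<epsilon> \<Delta>T *v U"

definition PA_I_coarse ::
  "real \<Rightarrow> real \<Rightarrow> real \<Rightarrow> real ^ ('n::{finite,linorder}) \<Rightarrow> real ^ ('n::{finite,linorder})" where
  "PA_I_coarse h \<epsilon> \<Delta>T U = P_mat 1 h \<epsilon> \<Delta>T *v U"

definition PA_I :: "nat \<Rightarrow> real \<Rightarrow> real \<Rightarrow> real \<Rightarrow> real ^ ('n::{finite,linorder})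
    \<Rightarrow> nat \<Rightarrow> nat \<Rightarrow> real ^ ('n::{finite,linorder})" where
  "PA_I J h \<epsilon> \<Delta>T u0 = parareal (PA_I_fine J h \<epsilon> \<Delta>T) (PA_I_coarse h \<epsilon> \<Delta>T) u0"

definition PA_I_error :: "nat \<Rightarrow> real \<Rightarrow> real \<Rightarrow> real \<Rightarrow> real ^ ('n::{finite,linorder})
    \<Rightarrow> nat \<Rightarrow> nat \<Rightarrow> real ^ ('n::{finite,linorder})" where
  "PA_I_error J h \<epsilon> \<Delta>T u0 k n =
     fine_solution (PA_I_fine J h \<epsilon> \<Delta>T) u0 n - PA_I J h \<epsilon> \<Delta>T u0 k n"

end

theory Submission
  imports Defs
begin

text \<open>
  Both propagators are linear, so the errors obey
  \<open>E\<^sub>n\<^sub>+\<^sub>1\<^sup>k\<^sup>+\<^sup>1 = G E\<^sub>n\<^sup>k\<^sup>+\<^sup>1 + (F - G) E\<^sub>n\<^sup>k\<close> with \<open>E\<^sub>0\<^sup>k = 0\<close>.  Taking norms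
  (\<open>parareal_error_step\<close>) leaves a two-index scalar recursion with coefficients \<open>\<beta>\<close> and \<open>\<alpha>\<close>.
  Unrolling it in \<open>n\<close> turns one iteration into a convolution with the powers of \<open>\<beta>\<close>.  Bounding
  the convolution by its largest row sum yields the geometric factor \<open>1 + \<beta> + \<dots> + \<beta>\<^sup>N\<^sup>-\<^sup>2\<close> per
  iteration (\<open>geometric_bound\<close>); replacing \<open>\<beta>\<close> by \<open>1\<close> and keeping the dependence on \<open>n\<close> makes the
  recursion that of Pascal's triangle and yields the binomial coefficient (\<open>binomial_bound\<close>).
  Convergence at a fixed time is even finite termination: after \<open>k\<close> iterations the first \<open>k\<close> steps
  are exact (\<open>parareal_exact\<close>).

  The scheme itself only enters through \<open>\<beta> < 1\<close> (\<open>mat_norm_step_mat_less_1\<close>), which is what allows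
  replacing \<open>\<beta>\<close> by \<open>1\<close> and writing the geometric sum as the quotient
  \<open>(1 - \<beta>\<^sup>N\<^sup>-\<^sup>1) / (1 - \<beta>)\<close>.  The symmetric matrix \<open>D\<close> is negative definite by summation
  by parts.  Write \<open>A = I - s D\<close> and \<open>B = A + t D\<^sup>2\<close>, where \<open>s \<ge> 0\<close> and \<open>t > 0\<close>.  These matrices
  commute, so with \<open>x = B w\<close> the coarse step sends \<open>x\<close> to \<open>A w\<close>, and
  \<open>\<parallel>B w\<parallel>\<^sup>2 \<ge> \<parallel>A w\<parallel>\<^sup>2 + 2 t (\<parallel>D w\<parallel>\<^sup>2 - s \<langle>D w, D (D w)\<rangle>) > \<parallel>A w\<parallel>\<^sup>2\<close> unless \<open>w = 0\<close>.  Compactness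
  of the unit sphere makes the strict contraction uniform.
\<close>

section \<open>The discrete Laplacian is negative definite\<close>

lemma bij_betw_pos: "bij_betw pos (UNIV :: 'n::{finite,linorder} set) {..<CARD('n)}"
proof -
  have mono: "pos i < pos j" if "i < j" for i j :: 'n
    unfolding pos_def using that by (auto intro!: psubset_card_mono)
  have inj: "inj (pos :: 'n \<Rightarrow> nat)"
    by (metis (mono_tags) injI linorder_neqE mono nat_less_le)
  have "range (pos :: 'n \<Rightarrow> nat) \<subseteq> {..<CARD('n)}"
  proof (rule image_subsetI)
    fix i :: 'n
    have "{..<i} \<subset> UNIV" by auto
    then show "pos i \<in> {..<CARD('n)}"
      unfolding pos_def by (simp add: psubset_card_mono)
  qed
  then have "range (pos :: 'n \<Rightarrow> nat) = {..<CARD('n)}"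
    by (simp add: card_subset_eq card_image[OF inj])
  with inj show ?thesis by (simp add: bij_betw_def)
qed

text \<open>
  The entries of \<open>w\<close>, moved to the indices \<open>1, \<dots>, m\<close> and extended by the homogeneous Dirichlet
  values at \<open>0\<close> and beyond \<open>m\<close>: with them every row of the Laplacian is the same second
  difference.
\<close>

definition dirichlet_ext :: "real ^ 'n::{finite,linorder} \<Rightarrow> nat \<Rightarrow> real" where
  "dirichlet_ext w k =
     (if 1 \<le> k \<and> k \<le> CARD('n) then w $ the_inv_into UNIV pos (k - 1) else 0)"

lemma dirichlet_ext_pos [simp]:
  fixes w :: "real ^ 'n::{finite,linorder}"
  shows "dirichlet_ext w (Suc (pos i)) = w $ i"
proof -
  have "pos i < CARD('n)" using bij_betw_pos[where 'n='n] by (auto simp: bij_betw_def)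
  then show ?thesis
    using bij_betw_pos[where 'n='n] by (simp add: dirichlet_ext_def bij_betw_def the_inv_into_f_f)
qed

lemma dirichlet_ext_0 [simp]: "dirichlet_ext w 0 = 0"
  by (simp add: dirichlet_ext_def)

lemma dirichlet_ext_beyond [simp]:
  fixes w :: "real ^ 'n::{finite,linorder}"
  shows "CARD('n) < k \<Longrightarrow> dirichlet_ext w k = 0"
  by (simp add: dirichlet_ext_def)

lemma tridiag_mult_component:
  fixes w :: "real ^ 'n::{finite,linorder}"
  shows "(tridiag 1 (-2) 1 *v w) $ i =
    dirichlet_ext w (pos i) - 2 * dirichlet_ext w (Suc (pos i)) + dirichlet_ext w (Suc (Suc (pos i)))"
proof -
  define p where "p = pos i"
  define u where "u = dirichlet_ext w"
  have p: "p < CARD('n)" using bij_betw_pos[where 'n='n] by (auto simp: bij_betw_def p_def)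
  have inj: "inj (pos :: 'n \<Rightarrow> nat)" using bij_betw_pos by (auto simp: bij_betw_def)
  define c :: "nat \<Rightarrow> real" where
    "c l = (if p = l then -2 else if p = Suc l then 1 else if l = Suc p then 1 else 0)" for l
  have "(tridiag 1 (-2) 1 *v w) $ i = (\<Sum>j\<in>(UNIV :: 'n set). c (pos j) * u (Suc (pos j)))"
    unfolding matrix_vector_mult_def tridiag_def c_def p_def u_def
    by (auto intro!: sum.cong simp: inj_eq[OF inj])
  also have "\<dots> = (\<Sum>l<CARD('n). c l * u (Suc l))"
    by (rule sum.reindex_bij_betw[OF bij_betw_pos])
  also have "\<dots> = (\<Sum>l<CARD('n). (if l = p then -2 * u (Suc l) else 0)
      + ((if p = Suc l then u (Suc l) else 0) + (if l = Suc p then u (Suc l) else 0)))"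
    by (rule sum.cong) (auto simp: c_def)
  also have "\<dots> = -2 * u (Suc p) + ((\<Sum>l<CARD('n). if p = Suc l then u (Suc l) else 0)
      + (\<Sum>l<CARD('n). if l = Suc p then u (Suc l) else 0))"
    using p by (simp add: sum.distrib sum.delta)
  also have "(\<Sum>l<CARD('n). if p = Suc l then u (Suc l) else 0) = u p"
  proof (cases p)
    case (Suc q)
    then have "(\<Sum>l<CARD('n). if p = Suc l then u (Suc l) else 0)
        = (\<Sum>l<CARD('n). if l = q then u (Suc l) else 0)"
      by (intro sum.cong) auto
    then show ?thesis using p Suc by (simp add: sum.delta)
  qed (simp add: u_def)
  also have "(\<Sum>l<CARD('n). if l = Suc p then u (Suc l) else 0) = u (Suc (Suc p))"
    by (simp add: sum.delta u_def)
  finally show ?thesis by (simp add: p_def u_def)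
qed

lemma summation_by_parts_second_difference:
  fixes u :: "nat \<Rightarrow> real"
  shows "(\<Sum>k<m. u (Suc k) * (u k - 2 * u (Suc k) + u (Suc (Suc k)))) =
    - (\<Sum>k<Suc m. (u (Suc k) - u k)\<^sup>2) + u (Suc m) * (u (Suc m) - u m) - u 0 * (u 1 - u 0)"
  by (induction m) (simp_all add: power2_eq_square algebra_simps)

lemma inner_tridiag:
  fixes w :: "real ^ 'n::{finite,linorder}"
  shows "w \<bullet> (tridiag 1 (-2) 1 *v w) =
    - (\<Sum>k\<le>CARD('n). (dirichlet_ext w (Suc k) - dirichlet_ext w k)\<^sup>2)"
proof -
  define u where "u = dirichlet_ext w"
  define g where "g k = u (Suc k) * (u k - 2 * u (Suc k) + u (Suc (Suc k)))" for k
  have "w \<bullet> (tridiag 1 (-2) 1 *v w) = (\<Sum>i\<in>(UNIV :: 'n set). g (pos i))"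
    by (simp add: inner_vec_def tridiag_mult_component u_def g_def)
  also have "\<dots> = (\<Sum>k<CARD('n). g k)"
    by (rule sum.reindex_bij_betw[OF bij_betw_pos])
  finally show ?thesis
    unfolding g_def summation_by_parts_second_difference by (simp add: u_def lessThan_Suc_atMost)
qed

text \<open>
  If all differences vanish, including those across the boundary, then the extension is constant,
  equal to its boundary value \<open>0\<close>.
\<close>

lemma inner_tridiag_less_0:
  fixes w :: "real ^ 'n::{finite,linorder}"
  assumes "w \<noteq> 0"
  shows "w \<bullet> (tridiag 1 (-2) 1 *v w) < 0"
proof (rule ccontr)
  define u where "u = dirichlet_ext w"
  assume "\<not> ?thesis"
  then have "(\<Sum>k\<le>CARD('n). (u (Suc k) - u k)\<^sup>2) = 0"
    unfolding inner_tridiag u_def by (simp add: antisym sum_nonneg)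
  then have step: "u (Suc k) = u k" if "k \<le> CARD('n)" for k
    using that by (simp add: sum_nonneg_eq_0_iff)
  have "u k = 0" if "k \<le> Suc (CARD('n))" for k
    using that by (induction k) (simp_all add: step, simp add: u_def)
  moreover have "pos i < CARD('n)" for i :: 'n
    using bij_betw_pos[where 'n='n] by (auto simp: bij_betw_def)
  ultimately have "w $ i = 0" for i
    using dirichlet_ext_pos[of w i] by (metis Suc_less_eq less_imp_le u_def)
  then show False using assms by (simp add: vec_eq_iff)
qed

lemma D_mat_mult: "D_mat h *v w = (1 / h\<^sup>2) *\<^sub>R (tridiag 1 (-2) 1 *v w)"
  by (simp add: D_mat_def scaleR_matrix_vector_assoc)

lemma inner_D_mat_less_0:
  assumes "h \<noteq> 0" and "w \<noteq> 0"
  shows "w \<bullet> (D_mat h *v w) < 0"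
  using inner_tridiag_less_0[OF assms(2)] assms(1) by (simp add: D_mat_mult divide_neg_pos)

lemma D_mat_symmetric: "(D_mat h *v x) \<bullet> y = x \<bullet> (D_mat h *v y)"
proof -
  have "transpose (D_mat h) = D_mat h"
    by (auto simp: transpose_def D_mat_def tridiag_def vec_eq_iff)
  then show ?thesis by (metis dot_lmul_matrix vector_transpose_matrix)
qed

section \<open>One implicit step is a strict contraction\<close>

text \<open>
  After expanding the square of the right-hand side, the cross term is
  \<open>2 t (\<parallel>d w\<parallel>\<^sup>2 - s \<langle>d w, d (d w)\<rangle>)\<close>; symmetry produces the square and negative definiteness
  makes the other part nonnegative.
\<close>

lemma norm_less_add_square:
  fixes d :: "'v::real_inner \<Rightarrow> 'v"
  assumes "linear d"
    and sym: "\<And>x y. d x \<bullet> y = x \<bullet> d y"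
    and neg: "\<And>x. x \<noteq> 0 \<Longrightarrow> x \<bullet> d x < 0"
    and "0 \<le> s" "0 < t" "w \<noteq> 0"
  shows "norm (w - s *\<^sub>R d w) < norm (w - s *\<^sub>R d w + t *\<^sub>R d (d w))"
proof -
  define y where "y = w - s *\<^sub>R d w"
  define z where "z = d (d w)"
  have "d w \<noteq> 0" using neg[OF \<open>w \<noteq> 0\<close>] by auto
  then have "0 < d w \<bullet> d w" by simp
  moreover have "s * (d w \<bullet> d (d w)) \<le> 0"
    using neg[OF \<open>d w \<noteq> 0\<close>] \<open>0 \<le> s\<close> by (simp add: mult_nonneg_nonpos)
  moreover have "y \<bullet> z = d w \<bullet> d w - s * (d w \<bullet> d (d w))"
    by (simp add: y_def z_def inner_diff_left sym[of w "d w"])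
  ultimately have "0 < y \<bullet> z" by linarith
  have "(y + t *\<^sub>R z) \<bullet> (y + t *\<^sub>R z) = y \<bullet> y + 2 * t * (y \<bullet> z) + t\<^sup>2 * (z \<bullet> z)"
    by (simp add: inner_add_left inner_add_right inner_commute power2_eq_square algebra_simps)
  moreover have "0 < t * (y \<bullet> z)" "0 \<le> t\<^sup>2 * (z \<bullet> z)"
    using \<open>0 < t\<close> \<open>0 < y \<bullet> z\<close> by simp_all
  ultimately have "y \<bullet> y < (y + t *\<^sub>R z) \<bullet> (y + t *\<^sub>R z)"
    by linarith
  then show ?thesis by (simp add: y_def z_def norm_lt)
qed

lemma matrix_inv_left:
  fixes B :: "real ^ 'n ^ 'n"
  assumes "\<And>x. B *v x = 0 \<Longrightarrow> x = 0"
  shows "matrix_inv B ** B = mat 1"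
proof -
  have "invertible B"
    using assms by (simp add: invertible_left_inverse matrix_left_invertible_ker)
  then show ?thesis
    unfolding invertible_def matrix_inv_def by (rule someI2_ex) simp
qed

text \<open>
  Every \<open>x\<close> has the form \<open>B w\<close> with the implicit matrix \<open>B\<close>, and the explicit matrix \<open>A\<close> commutes
  with \<open>B\<close>, so the step maps \<open>x\<close> to \<open>A w\<close> and the comparison of \<open>A w\<close> with \<open>B w\<close> applies.
\<close>

lemma norm_step_mat_less:
  fixes x :: "real ^ 'n::{finite,linorder}"
  assumes "h \<noteq> 0" "\<epsilon> \<noteq> 0" "0 < \<tau>" "x \<noteq> 0"
  shows "norm (step_mat i h \<epsilon> \<tau> *v x) < norm x"
proof -
  define s where "s = real i * \<tau>"
  define t where "t = \<epsilon>\<^sup>2 * \<tau>"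
  define D :: "real ^ ('n::{finite,linorder}) ^ ('n::{finite,linorder})" where "D = D_mat h"
  define A where "A = mat 1 - s *\<^sub>R D"
  define B where "B = A + t *\<^sub>R (D ** D)"
  have st: "0 \<le> s" "0 < t" using assms by (simp_all add: s_def t_def)
  have Aw: "A *v w = w - s *\<^sub>R (D *v w)" for w
    by (simp add: A_def matrix_vector_mult_diff_rdistrib scaleR_matrix_vector_assoc)
  have Bw: "B *v w = A *v w + t *\<^sub>R (D *v (D *v w))" for w
    by (simp add: B_def matrix_vector_mult_add_rdistrib scaleR_matrix_vector_assoc
        matrix_vector_mul_assoc)
  have AB_less: "norm (A *v w) < norm (B *v w)" if "w \<noteq> 0" for w
    unfolding Bw Aw
    using st that D_mat_symmetric inner_D_mat_less_0[OF \<open>h \<noteq> 0\<close>]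
    by (intro norm_less_add_square) (simp_all add: D_def)
  then have inv: "matrix_inv B ** B = mat 1"
    by (intro matrix_inv_left) (metis norm_not_less_zero norm_zero)
  have comm: "A *v (B *v w) = B *v (A *v w)" for w
    by (simp add: Aw Bw matrix_vector_mult_diff_distrib matrix_vector_right_distrib
        matrix_vector_mult_scaleR algebra_simps)
  define w where "w = matrix_inv B *v x"
  have x: "x = B *v w"
    using inv by (metis w_def matrix_left_right_inverse matrix_vector_mul_assoc matrix_vector_mul_lid)
  have "step_mat i h \<epsilon> \<tau> = matrix_inv B ** A"
    by (simp add: step_mat_def B_def A_def D_def s_def t_def mat_pow_def numeral_2_eq_2)
  then have "step_mat i h \<epsilon> \<tau> *v x = matrix_inv B *v (B *v (A *v w))"
    by (simp add: x comm flip: matrix_vector_mul_assoc)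
  also have "\<dots> = A *v w"
    by (metis inv matrix_vector_mul_assoc matrix_vector_mul_lid)
  finally have "step_mat i h \<epsilon> \<tau> *v x = A *v w" .
  moreover have "w \<noteq> 0" using x \<open>x \<noteq> 0\<close> by auto
  ultimately show ?thesis using AB_less[of w] by (simp add: x)
qed

text \<open>The maximum of \<open>\<parallel>A x\<parallel>\<close> over the unit sphere is attained, hence itself below \<open>1\<close>.\<close>

lemma mat_norm_less_1:
  fixes A :: "real ^ 'n ^ 'n"
  assumes "\<And>x. x \<noteq> 0 \<Longrightarrow> norm (A *v x) < norm x"
  shows "mat_norm A < 1"
proof -
  have cont: "continuous_on (sphere 0 1) (\<lambda>x. norm (A *v x))"
    by (intro continuous_on_norm linear_continuous_on) simp
  have "sphere (0::real^'n) 1 \<noteq> {}" by simp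
  from continuous_attains_sup[OF compact_sphere this cont]
  obtain v where v: "norm v = 1"
    and max: "\<And>x. norm x = 1 \<Longrightarrow> norm (A *v x) \<le> norm (A *v v)"
    by auto
  have "norm (A *v x) \<le> norm (A *v v) * norm x" for x
  proof (cases "x = 0")
    case False
    have "norm (A *v ((1 / norm x) *\<^sub>R x)) \<le> norm (A *v v)"
      using False by (intro max) simp
    then show ?thesis
      using False by (simp add: matrix_vector_mult_scaleR field_simps)
  qed simp
  then have "mat_norm A \<le> norm (A *v v)"
    unfolding mat_norm_def by (rule onorm_le)
  also have "\<dots> < 1"
    using assms[of v] v by fastforce
  finally show ?thesis .
qed

lemma mat_norm_step_mat_less_1:
  assumes "h \<noteq> 0" "\<epsilon> \<noteq> 0" "0 < \<tau>"
  shows "mat_norm (step_mat i h \<epsilon> \<tau> :: real ^ ('n::{finite,linorder}) ^ ('n::{finite,linorder})) < 1"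
  by (intro mat_norm_less_1 norm_step_mat_less assms)

section \<open>The Parareal error recursion\<close>

lemma fine_solution_Suc: "fine_solution F u0 (Suc n) = F (fine_solution F u0 n)"
  by (simp add: fine_solution_def)

text \<open>
  Where the previous iterate and the current one both agree with the fine solution, the two coarse
  terms cancel and only the fine step remains.
\<close>

lemma parareal_exact: "n \<le> k \<Longrightarrow> parareal F G u0 k n = fine_solution F u0 n"
proof (induction n arbitrary: k)
  case 0
  then show ?case by (simp add: fine_solution_def)
next
  case (Suc n)
  then obtain l where "k = Suc l" "n \<le> l" by (cases k) auto
  then show ?case using Suc.IH[of k] Suc.IH[of l] by (simp add: fine_solution_Suc)
qed

lemma parareal_converges:
  fixes F G :: "'v::{ab_group_add,topological_space} \<Rightarrow> 'v"
  shows "(\<lambda>k. parareal F G u0 k n) \<longlonglongrightarrow> fine_solution F u0 n"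
  by (rule tendsto_eventually, rule eventually_sequentiallyI[of n]) (rule parareal_exact)

text \<open>
  Lipschitz constants of \<open>G\<close> and of \<open>F - G\<close> suffice, because the error splits into the increment
  of \<open>G\<close> between the fine solution and the new iterate, and the increment of \<open>F - G\<close> between
  the fine solution and the old one.
\<close>

lemma parareal_error_step:
  fixes F G :: "'v::real_normed_vector \<Rightarrow> 'v"
  assumes G: "\<And>x y. norm (G x - G y) \<le> \<beta> * norm (x - y)"
    and FG: "\<And>x y. norm ((F x - G x) - (F y - G y)) \<le> \<alpha> * norm (x - y)"
  shows "norm (fine_solution F u0 (Suc n) - parareal F G u0 (Suc k) (Suc n))
    \<le> \<beta> * norm (fine_solution F u0 n - parareal F G u0 (Suc k) n)
      + \<alpha> * norm (fine_solution F u0 n - parareal F G u0 k n)"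
proof -
  define v x y where "v = fine_solution F u0 n"
    and "x = parareal F G u0 (Suc k) n" and "y = parareal F G u0 k n"
  have "fine_solution F u0 (Suc n) - parareal F G u0 (Suc k) (Suc n)
      = (G v - G x) + ((F v - G v) - (F y - G y))"
    by (simp add: fine_solution_Suc v_def x_def y_def)
  then show ?thesis
    using norm_triangle_mono[OF G[of v x] FG[of v y]] by (simp only: v_def x_def y_def)
qed

section \<open>Solving the scalar error recursion\<close>

text \<open>
  The bound at step \<open>n + 1\<close> has the partial sum with \<open>n\<close> terms: the error vanishes at \<open>0\<close> in every
  iteration, so the first step contributes nothing.
\<close>

lemma convolution_bound:
  fixes e e' :: "nat \<Rightarrow> real"
  assumes "e 0 = 0" "e' 0 = 0" "0 \<le> \<alpha>" "0 \<le> \<beta>"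
    and rec: "\<And>n. e' (Suc n) \<le> \<beta> * e' n + \<alpha> * e n"
    and e: "\<And>n. n < N \<Longrightarrow> e (Suc n) \<le> M"
    and "n < N"
  shows "e' (Suc n) \<le> \<alpha> * M * (\<Sum>i<n. \<beta> ^ i)"
  using \<open>n < N\<close>
proof (induction n)
  case 0
  then show ?case using rec[of 0] assms by simp
next
  case (Suc n)
  have "e' (Suc (Suc n)) \<le> \<beta> * e' (Suc n) + \<alpha> * e (Suc n)"
    by (rule rec)
  also have "\<dots> \<le> \<beta> * (\<alpha> * M * (\<Sum>i<n. \<beta> ^ i)) + \<alpha> * M"
    using Suc assms by (intro add_mono mult_left_mono) auto
  also have "\<dots> = \<alpha> * M * (\<Sum>i<Suc n. \<beta> ^ i)"
    unfolding sum.lessThan_Suc_shift by (simp add: sum_distrib_left algebra_simps)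
  finally show ?case .
qed

lemma geometric_bound:
  fixes e :: "nat \<Rightarrow> nat \<Rightarrow> real"
  assumes "\<And>k. e k 0 = 0" "0 \<le> \<alpha>" "0 \<le> \<beta>" "0 \<le> M"
    and "\<And>k n. e (Suc k) (Suc n) \<le> \<beta> * e (Suc k) n + \<alpha> * e k n"
    and "\<And>n. n < N \<Longrightarrow> e 0 (Suc n) \<le> M"
    and "n < N"
  shows "e k (Suc n) \<le> \<alpha> ^ k * (\<Sum>i<N - 1. \<beta> ^ i) ^ k * M"
  using \<open>n < N\<close>
proof (induction k arbitrary: n)
  case 0
  then show ?case using assms by simp
next
  case (Suc k)
  define C where "C = \<alpha> ^ k * (\<Sum>i<N - 1. \<beta> ^ i) ^ k * M"
  have "e (Suc k) (Suc n) \<le> \<alpha> * C * (\<Sum>i<n. \<beta> ^ i)"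
    using assms Suc by (intro convolution_bound[of "e k" _ _ _ N]) (simp_all add: C_def)
  also have "\<dots> \<le> \<alpha> * C * (\<Sum>i<N - 1. \<beta> ^ i)"
    using assms Suc.prems unfolding C_def
    by (intro mult_left_mono sum_mono2 mult_nonneg_nonneg zero_le_power sum_nonneg) auto
  finally show ?case by (simp add: C_def mult_ac)
qed

text \<open>
  With \<open>\<beta>\<close> replaced by \<open>1\<close>, equality in the recursion is Pascal's rule for
  \<open>\<alpha>\<^sup>k (n choose k)\<close>; hence the double induction, on \<open>k\<close> and then on \<open>n\<close>.
\<close>

lemma binomial_bound:
  fixes e :: "nat \<Rightarrow> nat \<Rightarrow> real"
  assumes "\<And>k. e k 0 = 0" "\<And>k n. 0 \<le> e k n" "0 \<le> \<alpha>" "\<beta> \<le> 1"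
    and rec: "\<And>k n. e (Suc k) (Suc n) \<le> \<beta> * e (Suc k) n + \<alpha> * e k n"
    and "\<And>n. n < N \<Longrightarrow> e 0 (Suc n) \<le> M"
    and "n < N"
  shows "e k (Suc n) \<le> \<alpha> ^ k * real (n choose k) * M"
  using \<open>n < N\<close>
proof (induction k arbitrary: n)
  case 0
  then show ?case using assms by simp
next
  case (Suc k)
  note outer = Suc.IH
  from Suc.prems show ?case
  proof (induction n)
    case 0
    then show ?case using rec[of k 0] assms by simp
  next
    case (Suc n)
    have "e (Suc k) (Suc (Suc n)) \<le> \<beta> * e (Suc k) (Suc n) + \<alpha> * e k (Suc n)"
      by (rule rec)
    also have "\<dots> \<le> 1 * e (Suc k) (Suc n) + \<alpha> * e k (Suc n)"
      using assms by (intro add_right_mono mult_right_mono) auto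
    also have "\<dots> \<le> \<alpha> ^ Suc k * real (n choose Suc k) * M + \<alpha> * (\<alpha> ^ k * real (n choose k) * M)"
      using Suc outer[of n] assms by (intro add_mono mult_left_mono) auto
    also have "\<dots> = \<alpha> ^ Suc k * real (Suc n choose Suc k) * M"
      by (simp add: algebra_simps)
    finally show ?case .
  qed
qed

section \<open>Convergence of PA-I\<close>

lemma norm_mult_le_mat_norm: "norm (A *v x) \<le> mat_norm A * norm x"
  unfolding mat_norm_def by (rule onorm) simp

lemma mat_norm_nonneg: "0 \<le> mat_norm A"
  unfolding mat_norm_def by (rule onorm_pos_le) simp

theorem theorem3p7:
  fixes h \<epsilon> T \<Delta>T \<alpha> \<beta> :: real
    and Nx N J :: nat
    and u0 :: "real ^ ('n::{finite,linorder})"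
    and E :: "nat \<Rightarrow> nat \<Rightarrow> real ^ ('n::{finite,linorder})"
  assumes "h > 0" and "Nx \<ge> 3" and "CARD('n) = Nx - 2"
    and "\<epsilon> > 0" and "T > 0" and "N \<ge> 1" and "J \<ge> 2"
    and "\<Delta>T = T / real N"
    and "\<alpha> = mat_norm (PJ_mat J 1 h \<epsilon> \<Delta>T - P_mat 1 h \<epsilon> \<Delta>T :: real ^ ('n::{finite,linorder}) ^ ('n::{finite,linorder}))"
    and "\<beta> = mat_norm (P_mat 1 h \<epsilon> \<Delta>T :: real ^ ('n::{finite,linorder}) ^ ('n::{finite,linorder}))"
    and "E = PA_I_error J h \<epsilon> \<Delta>T u0"
  shows "(\<forall>n\<le>N. (\<lambda>k. PA_I J h \<epsilon> \<Delta>T u0 k n) \<longlonglongrightarrow> fine_solution (PA_I_fine J h \<epsilon> \<Delta>T) u0 n)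
    \<and> (\<forall>k. (MAX j\<in>{1..N}. norm (E (k + 1) j))
          \<le> \<alpha> ^ (k + 1)
            * min (((1 - \<beta> ^ (N - 1)) / (1 - \<beta>)) ^ (k + 1)) (real ((N - 1) choose (k + 1)))
            * (MAX j\<in>{1..N}. norm (E 0 j)))"
proof (intro conjI allI impI)
  fix n assume "n \<le> N"
  show "(\<lambda>k. PA_I J h \<epsilon> \<Delta>T u0 k n) \<longlonglongrightarrow> fine_solution (PA_I_fine J h \<epsilon> \<Delta>T) u0 n"
    unfolding PA_I_def by (rule parareal_converges)
next
  fix k
  define e where "e k n = norm (E k n)" for k n
  define M where "M = (MAX j\<in>{1..N}. e 0 j)"
  have "0 < \<Delta>T" using assms by simp
  then have \<beta>: "0 \<le> \<beta>" "\<beta> < 1" and \<alpha>: "0 \<le> \<alpha>"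
    using assms by (simp_all add: mat_norm_nonneg P_mat_def mat_norm_step_mat_less_1)
  have e0: "e k 0 = 0" for k
    by (simp add: e_def assms(11) PA_I_error_def PA_I_def fine_solution_def)
  have rec: "e (Suc k) (Suc n) \<le> \<beta> * e (Suc k) n + \<alpha> * e k n" for k n
    unfolding e_def assms(11) PA_I_error_def PA_I_def
  proof (rule parareal_error_step)
    fix x y :: "real ^ ('n::{finite,linorder})"
    show "norm (PA_I_coarse h \<epsilon> \<Delta>T x - PA_I_coarse h \<epsilon> \<Delta>T y) \<le> \<beta> * norm (x - y)"
      unfolding PA_I_coarse_def assms(10) matrix_vector_mult_diff_distrib[symmetric]
      by (rule norm_mult_le_mat_norm)
    have "PA_I_fine J h \<epsilon> \<Delta>T x - PA_I_coarse h \<epsilon> \<Delta>T x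
        - (PA_I_fine J h \<epsilon> \<Delta>T y - PA_I_coarse h \<epsilon> \<Delta>T y)
        = (PJ_mat J 1 h \<epsilon> \<Delta>T - P_mat 1 h \<epsilon> \<Delta>T) *v (x - y)"
      by (simp add: PA_I_fine_def PA_I_coarse_def matrix_vector_mult_diff_distrib
          matrix_vector_mult_diff_rdistrib)
    then show "norm (PA_I_fine J h \<epsilon> \<Delta>T x - PA_I_coarse h \<epsilon> \<Delta>T x
        - (PA_I_fine J h \<epsilon> \<Delta>T y - PA_I_coarse h \<epsilon> \<Delta>T y)) \<le> \<alpha> * norm (x - y)"
      unfolding assms(9) by (simp only: norm_mult_le_mat_norm)
  qed
  have M: "e 0 (Suc n) \<le> M" if "n < N" for n
    unfolding M_def using that by (intro Max_ge) auto
  have e_nonneg: "0 \<le> e k n" for k n by (simp add: e_def)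
  have "0 \<le> M" using M[of 0] e_nonneg[of 0 1] \<open>N \<ge> 1\<close> by simp
  define S where "S = (1 - \<beta> ^ (N - 1)) / (1 - \<beta>)"
  have S: "(\<Sum>i<N - 1. \<beta> ^ i) = S"
    using \<beta> by (simp add: S_def sum_gp_strict)
  have bound: "e (k + 1) j \<le> \<alpha> ^ (k + 1) * min (S ^ (k + 1)) (real ((N - 1) choose (k + 1))) * M"
    if j: "j \<in> {1..N}" for j
  proof -
    obtain n where n: "j = Suc n" "n < N" using j by (cases j) auto
    have "e (k + 1) j \<le> \<alpha> ^ (k + 1) * S ^ (k + 1) * M"
      using geometric_bound[where e = e and k = "k + 1", OF e0 \<alpha> \<beta>(1) \<open>0 \<le> M\<close> rec M n(2)]
      by (simp only: S n(1))
    moreover have "e (k + 1) j \<le> \<alpha> ^ (k + 1) * real (n choose (k + 1)) * M"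
      using binomial_bound[where e = e and k = "k + 1",
          OF e0 e_nonneg \<alpha> less_imp_le[OF \<beta>(2)] rec M n(2)]
      by (simp only: n(1))
    moreover have "\<alpha> ^ (k + 1) * real (n choose (k + 1)) * M
        \<le> \<alpha> ^ (k + 1) * real ((N - 1) choose (k + 1)) * M"
      using \<alpha> \<open>0 \<le> M\<close> n(2)
      by (intro mult_right_mono mult_left_mono) (auto intro!: binomial_right_mono)
    ultimately show ?thesis by (simp add: min_def)
  qed
  have "(MAX j\<in>{1..N}. e (k + 1) j)
      \<le> \<alpha> ^ (k + 1) * min (S ^ (k + 1)) (real ((N - 1) choose (k + 1))) * M"
    using bound \<open>N \<ge> 1\<close> by (intro Max.boundedI) auto
  then show "(MAX j\<in>{1..N}. norm (E (k + 1) j))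
      \<le> \<alpha> ^ (k + 1)
        * min (((1 - \<beta> ^ (N - 1)) / (1 - \<beta>)) ^ (k + 1)) (real ((N - 1) choose (k + 1)))
        * (MAX j\<in>{1..N}. norm (E 0 j))"
    by (simp only: e_def M_def S_def)
qed

end
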